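(* The set of all dissipative quadratic stochastic operators $V:S^{m-1}\to S^{m-1}$ is not convex.
   Context: $S^{m-1}=\{x\in\mathbb{R}^m: x_i\ge 0,\ \sum_{i=1}^m x_i=1\}$. A quadratic stochastic operator (q.s.o.) is a map $V:S^{m-1}\to S^{m-1}$ of the form $(Vx)_k=\sum_{i,j=1}^m p_{ij,k}x_ix_j$, $k=1,\dots,m$, where $p_{ij,k}=p_{ji,k}\ge 0$ and $\sum_{k=1}^m p_{ij,k}=1$ for all $i,j$. For $x\in\mathbb{R}^m$, let $x_{[1]}\ge\cdots\ge x_{[m]}$ denote the coordinates of $x$ in decreasing order. For $x,y\in\mathbb{R}^m$, write $x\prec y$ (equivalently $y\succ x$) if $\sum_{i=1}^k x_{[i]}\le\sum_{i=1}^k y_{[i]}$ for $k=1,\dots,m-1$ and $\sum_{i=1}^m x_{[i]}=\sum_{i=1}^m y_{[i]}$. $V$ is dissipative if $Vx\succ x$ for all $x\in S^{m-1}$. Convex combinations of operators are taken pointwise. *)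

theory Defs
  imports "HOL-Analysis.Analysis" "HOL-Library.Function_Algebras"
begin

(* The pointwise real vector space structure on maps, so that the library predicate convex
   applies to sets of operators. *)

instantiation "fun" :: (type, real_vector) real_vector
begin

definition scaleR_fun :: "real \<Rightarrow> ('a \<Rightarrow> 'b) \<Rightarrow> 'a \<Rightarrow> 'b" where
  "scaleR_fun c f = (\<lambda>x. c *\<^sub>R f x)"

instance
  by standard (auto simp: scaleR_fun_def fun_eq_iff scaleR_add_right scaleR_add_left)

end

definition prob_simplex :: "(real ^ 'n) set" where
  "prob_simplex = {x. (\<forall>i. x $ i \<ge> 0) \<and> (\<Sum>i\<in>UNIV. x $ i) = 1}"

(* Maps of the simplex into itself are extensional, i.e. have the fixed value undefined
   elsewhere, so HOL functions correspond to set-theoretic maps one to one.  A pointwise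
   convex combination of extensional functions is again extensional, because its weights
   add up to 1. *)

definition qso :: "(real ^ 'n \<Rightarrow> real ^ 'n) \<Rightarrow> bool" where
  "qso V \<longleftrightarrow> V \<in> prob_simplex \<rightarrow>\<^sub>E prob_simplex \<and>
     (\<exists>p :: 'n \<Rightarrow> 'n \<Rightarrow> 'n \<Rightarrow> real.
        (\<forall>i j k. p i j k = p j i k \<and> p i j k \<ge> 0) \<and>
        (\<forall>i j. (\<Sum>k\<in>UNIV. p i j k) = 1) \<and>
        (\<forall>x\<in>prob_simplex. \<forall>k. V x $ k = (\<Sum>i\<in>UNIV. \<Sum>j\<in>UNIV. p i j k * x $ i * x $ j)))"

(* The i-th largest coordinate, counted with multiplicity and starting from i = 1. *)

definition decr_coord :: "real ^ 'n \<Rightarrow> nat \<Rightarrow> real" where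
  "decr_coord x i =
     rev (sorted_list_of_multiset (image_mset (\<lambda>j. x $ j) (mset_set UNIV))) ! (i - 1)"

definition majorized :: "real ^ 'n \<Rightarrow> real ^ 'n \<Rightarrow> bool" where
  "majorized x y \<longleftrightarrow>
     (\<forall>k\<in>{1..CARD('n) - 1}. (\<Sum>i=1..k. decr_coord x i) \<le> (\<Sum>i=1..k. decr_coord y i)) \<and>
     (\<Sum>i=1..CARD('n). decr_coord x i) = (\<Sum>i=1..CARD('n). decr_coord y i)"

definition dissipative :: "(real ^ 'n \<Rightarrow> real ^ 'n) \<Rightarrow> bool" where
  "dissipative V \<longleftrightarrow> (\<forall>x\<in>prob_simplex. majorized x (V x))"

end

theory Submission
  imports Defs
begin

text \<open>Permuting coordinates is a dissipative operator, since it leaves the decreasing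
  rearrangement unchanged. The midpoint of the identity and the transposition of two coordinates
  \<open>a\<close>, \<open>b\<close> sends the vertex \<open>axis a 1\<close> to the midpoint of an edge, whose largest coordinate is
  \<open>1/2 < 1\<close>.\<close>

definition permute_coords :: "('n \<Rightarrow> 'n) \<Rightarrow> real ^ 'n \<Rightarrow> real ^ 'n" where
  "permute_coords \<pi> = (\<lambda>x\<in>prob_simplex. \<chi> k. x $ \<pi> k)"

lemma permute_coords_in_prob_simplex:
  fixes \<pi> :: "'n::finite \<Rightarrow> 'n"
  assumes "bij \<pi>" and "x \<in> prob_simplex"
  shows "permute_coords \<pi> x \<in> prob_simplex"
proof -
  have "(\<Sum>k\<in>UNIV. x $ \<pi> k) = (\<Sum>k\<in>UNIV. x $ k)"
    using assms(1) by (rule sum.reindex_bij_betw)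
  then show ?thesis
    using assms(2) by (simp add: permute_coords_def prob_simplex_def)
qed

text \<open>A linear form agrees on the simplex with a quadratic one: multiply it by the coordinate
  sum, which is 1 there.\<close>

lemma qso_permute_coords:
  fixes \<pi> :: "'n::finite \<Rightarrow> 'n"
  assumes "bij \<pi>"
  shows "qso (permute_coords \<pi>)"
proof -
  \<comment> \<open>The coefficients of \<open>x $ \<pi> k\<close> times the coordinate sum,
    averaged over the two orders of \<open>i\<close> and \<open>j\<close> to make them
    symmetric.\<close>
  define p :: "'n \<Rightarrow> 'n \<Rightarrow> 'n \<Rightarrow> real"
    where "p i j k = (of_bool (i = \<pi> k) + of_bool (j = \<pi> k)) / 2" for i j k
  \<comment> \<open>Bijectivity enters here: each \<open>i\<close> has exactly one preimage under
    \<open>\<pi>\<close>.\<close>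
  have count: "(\<Sum>k\<in>UNIV. of_bool (i = \<pi> k)) = (1::real)" for i
    using sum.reindex_bij_betw[OF assms, of "\<lambda>k. of_bool (i = k) :: real"]
    by (simp add: of_bool_def)
  have p_sum: "(\<Sum>k\<in>UNIV. p i j k) = 1" for i j
    by (simp add: p_def sum.distrib count flip: sum_divide_distrib)
  have p_val: "permute_coords \<pi> x $ k = (\<Sum>i\<in>UNIV. \<Sum>j\<in>UNIV. p i j k * x $ i * x $ j)"
    if "x \<in> prob_simplex" for x k
  proof -
    have 1: "(\<Sum>i\<in>UNIV. x $ i) = 1"
      using that by (simp add: prob_simplex_def)
    have "(\<Sum>i\<in>UNIV. \<Sum>j\<in>UNIV. p i j k * x $ i * x $ j)
        = ((\<Sum>i\<in>UNIV. of_bool (i = \<pi> k) * x $ i) * (\<Sum>j\<in>UNIV. x $ j)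
         + (\<Sum>i\<in>UNIV. x $ i) * (\<Sum>j\<in>UNIV. of_bool (j = \<pi> k) * x $ j)) / 2"
      unfolding sum_product sum.distrib[symmetric] sum_divide_distrib
      by (intro sum.cong refl) (simp add: p_def field_simps)
    also have "\<dots> = x $ \<pi> k"
      by (simp add: 1 of_bool_def if_distrib[where f = "\<lambda>c. c * _"] cong: if_cong)
    finally show ?thesis
      using that by (simp add: permute_coords_def)
  qed
  \<comment> \<open>Extensionality comes from the restricted abstraction in
    \<open>permute_coords\<close>.\<close>
  have "permute_coords \<pi> \<in> prob_simplex \<rightarrow>\<^sub>E prob_simplex"
    using permute_coords_in_prob_simplex[OF assms] by (auto simp: permute_coords_def)
  moreover have "p i j k = p j i k \<and> p i j k \<ge> 0" for i j k
    by (simp add: p_def)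
  ultimately show ?thesis
    unfolding qso_def using p_sum p_val by blast
qed

text \<open>\<open>decr_coord\<close> depends only on the multiset of coordinates, which a bijection
  of the indices preserves; majorization then holds with equality throughout.\<close>

lemma dissipative_permute_coords:
  fixes \<pi> :: "'n::finite \<Rightarrow> 'n"
  assumes "bij \<pi>"
  shows "dissipative (permute_coords \<pi>)"
proof -
  have "decr_coord (permute_coords \<pi> x) = decr_coord x" if "x \<in> prob_simplex" for x
  proof -
    have "image_mset (\<lambda>j. x $ \<pi> j) (mset_set UNIV)
        = image_mset (($) x) (image_mset \<pi> (mset_set UNIV))"
      by (simp add: image_mset.compositionality comp_def)
    also have "image_mset \<pi> (mset_set UNIV) = mset_set UNIV"
      using assms by (simp add: image_mset_mset_set bij_is_inj bij_is_surj)
    finally show ?thesis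
      using that by (simp add: decr_coord_def permute_coords_def fun_eq_iff)
  qed
  then show ?thesis
    by (simp add: dissipative_def majorized_def)
qed

text \<open>Index 1 reads position 0 of the reversed ascending list, that is, the last entry of the
  sorted list.\<close>

lemma decr_coord_1:
  fixes x :: "real ^ 'n::finite"
  shows "decr_coord x 1 = Max (range (($) x))"
proof -
  define xs where "xs = sorted_list_of_multiset (image_mset (($) x) (mset_set UNIV))"
  have set_xs: "set xs = range (($) x)"
    by (simp add: xs_def)
  then have "xs \<noteq> []"
    by auto
  moreover have "sorted xs"
    by (simp add: xs_def)
  ultimately have "last xs = Max (set xs)"
    by (intro Max_eqI[symmetric])
      (auto simp: in_set_conv_nth last_conv_nth sorted_iff_nth_mono
        intro!: exI[of _ "length xs - 1"])
  then show ?thesis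
    using \<open>xs \<noteq> []\<close> set_xs
    by (simp add: decr_coord_def xs_def[symmetric] hd_rev flip: hd_conv_nth)
qed

text \<open>This is the partial-sum inequality for \<open>k = 1\<close>, which lies in the range
  \<open>{1..CARD('n) - 1}\<close> because the dimension is at least 2.\<close>

lemma majorized_imp_Max_le:
  fixes x y :: "real ^ 'n::finite"
  assumes "CARD('n) \<ge> 2" and "majorized x y"
  shows "Max (range (($) x)) \<le> Max (range (($) y))"
proof -
  have "1 \<in> {1..CARD('n) - 1}"
    using assms(1) by simp
  with assms(2) have "(\<Sum>i=1..1. decr_coord x i) \<le> (\<Sum>i=1..1. decr_coord y i)"
    unfolding majorized_def by blast
  then show ?thesis
    using decr_coord_1[of x] decr_coord_1[of y] by simp
qed

theorem mainTheorem7: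
  assumes "CARD('n::finite) \<ge> 2"
  shows "\<not> convex {V :: real ^ 'n \<Rightarrow> real ^ 'n. qso V \<and> dissipative V}"
proof
  let ?D = "{V :: real ^ 'n \<Rightarrow> real ^ 'n. qso V \<and> dissipative V}"
  assume "convex ?D"
  obtain a b :: 'n where "a \<noteq> b"
    using assms by (metis card_2_iff' ex_card)
  define V where "V = (1/2) *\<^sub>R permute_coords id + (1/2) *\<^sub>R permute_coords (Transposition.transpose a b)"
  define y where "y = V (axis a 1)"
  have "V \<in> ?D"
    unfolding V_def
    by (intro convexD[OF \<open>convex ?D\<close>] CollectI conjI qso_permute_coords
        dissipative_permute_coords) auto
  moreover have e: "axis a 1 \<in> (prob_simplex :: (real ^ 'n) set)"
    by (simp add: prob_simplex_def axis_def)
  ultimately have "majorized (axis a 1) y"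
    by (simp add: dissipative_def y_def)
  then have "Max (range (($) (axis a 1 :: real ^ 'n))) \<le> Max (range (($) y))"
    by (rule majorized_imp_Max_le[OF assms])
  moreover have "Max (range (($) (axis a 1 :: real ^ 'n))) \<ge> 1"
    by (intro Max_ge) (auto simp: axis_def image_iff)
  \<comment> \<open>The identity puts weight 1/2 on \<open>a\<close> and the transposition puts 1/2
    on \<open>b\<close>; since \<open>a \<noteq> b\<close>, these never add up in one
    coordinate.\<close>
  moreover have "y $ k \<le> 1/2" for k
    using e \<open>a \<noteq> b\<close>
    by (auto simp: y_def V_def permute_coords_def plus_fun_def scaleR_fun_def axis_def
        Transposition.transpose_def)
  then have "Max (range (($) y)) \<le> 1/2"
    by (intro Max.boundedI) auto
  ultimately show False
    by linarith
qed

end
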